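(* Let $m,n\ge 1$ be integers, let $p_1,\dots,p_m>0$ with $\sum_{i=1}^m p_i=1$, and let $Y=(Y_1,\dots,Y_n)$ be a vector of i.i.d. random variables with $P(Y_\ell=i)=p_i$ for all $i\in[m]$ and $\ell\in[n]$. Let $\mathcal N_n$ be the empirical nerve (random interval graph) of $Y$, and let $X$ be the number of edges of the graph $\mathcal N_n$. Then, with $q_{ij}=1-(p_i+p_j)$, $$\mathbb E X=\sum_{1\le i<j\le m}\left(1-q_{ij}^n-\sum_{k=1}^n\binom nk\left[\left(2\sum_{r=1}^{k-1}p_i^r p_j^{k-r}\right)+p_i^k+p_j^k\right]q_{ij}^{\,n-k}\right).$$ In the uniform case where $p_i=\frac1m$ for all $i\in[m]$, this expectation equals $$\binom m2\left(1-\frac{2n(m-1)^{n-1}+(m-2)^n}{m^n}\right).$$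
   Context: Notation: $[N]=\{1,\dots,N\}$. For each label $i\in[m]$, the empirical support is $I_n(i)=\mathrm{Conv}(\{\ell\in[n]:Y_\ell=i\})\subset\mathbb R$, i.e. the closed interval from the first to the last index at which label $i$ occurs (possibly a single point; empty if label $i$ does not occur). The empirical nerve $\mathcal N_n$ is the abstract simplicial complex whose simplices are the nonempty subsets $J\subseteq[m]$ with $\bigcap_{i\in J}I_n(i)\ne\emptyset$; its 1-skeleton, denoted by the same symbol, is the graph whose vertices are the labels $i$ with $I_n(i)\neq\emptyset$ and in which $\{i,j\}$, $i\ne j$, is an edge iff $I_n(i)\cap I_n(j)\neq\emptyset$. Convention: $0^0=1$. *)

theory Defs
  imports "HOL-Probability.Probability"
begin

text \<open>
  A sample \<open>Y\<^sub>1, \<dots>, Y\<^sub>n\<close> of labels is a function \<open>y :: nat \<Rightarrow> nat\<close>, of which only the values on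
  \<open>{1..n}\<close> matter; the labels are \<open>{1..m}\<close>.
\<close>

definition empirical_support :: "nat \<Rightarrow> (nat \<Rightarrow> nat) \<Rightarrow> nat \<Rightarrow> real set" where
  "empirical_support n y i = convex hull (real ` {l \<in> {1..n}. y l = i})"

definition empirical_nerve :: "nat \<Rightarrow> nat \<Rightarrow> (nat \<Rightarrow> nat) \<Rightarrow> nat set set" where
  "empirical_nerve m n y =
     {J. J \<subseteq> {1..m} \<and> J \<noteq> {} \<and> (\<Inter>i\<in>J. empirical_support n y i) \<noteq> {}}"

definition nerve_vertices :: "nat \<Rightarrow> nat \<Rightarrow> (nat \<Rightarrow> nat) \<Rightarrow> nat set" where
  "nerve_vertices m n y = {i \<in> {1..m}. empirical_support n y i \<noteq> {}}"

definition nerve_edges :: "nat \<Rightarrow> nat \<Rightarrow> (nat \<Rightarrow> nat) \<Rightarrow> nat set set" where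
  "nerve_edges m n y =
     {{i, j} | i j. i \<in> nerve_vertices m n y \<and> j \<in> nerve_vertices m n y \<and> i \<noteq> j \<and>
        empirical_support n y i \<inter> empirical_support n y j \<noteq> {}}"

text \<open>The graph above is the 1-skeleton of the nerve.\<close>

lemma nerve_vertices_iff_simplex:
  "i \<in> nerve_vertices m n y \<longleftrightarrow> {i} \<in> empirical_nerve m n y"
  by (simp add: nerve_vertices_def empirical_nerve_def)

lemma nerve_edges_eq_simplices:
  "nerve_edges m n y = {J \<in> empirical_nerve m n y. card J = 2}"
  by (auto simp: nerve_edges_def nerve_vertices_def empirical_nerve_def card_2_iff) blast+

end

theory Submission imports Defs begin

text \<open>
  The supports of two labels \<open>i \<noteq> j\<close> fail to meet exactly if every occurrence of \<open>i\<close> precedes every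
  occurrence of \<open>j\<close>, or conversely; both happen iff one of the labels does not occur. Splitting
  according to the last occurrence of \<open>i\<close> turns ``\<open>i\<close> precedes \<open>j\<close>'' into a disjoint union of events
  that restrict each \<open>Y\<^sub>l\<close> separately, which gives its probability as
  \<open>(1 - a)\<^sup>n + (\<Sum>s. a (1 - b)\<^sup>s\<^sup>-\<^sup>1 (1 - a)\<^sup>n\<^sup>-\<^sup>s)\<close> with \<open>a = p\<^sub>i\<close> and \<open>b = p\<^sub>j\<close>. The binomial sum
  over the number \<open>k\<close> of occurrences of \<open>i\<close> and \<open>j\<close> satisfies the same recursion in \<open>n\<close>.
\<close>

section \<open>Disjoint supports and the order of occurrences\<close>

lemma convex_real_inter_empty_iff:
  fixes A B :: "real set"
  assumes "convex A" "convex B"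
  shows "A \<inter> B = {} \<longleftrightarrow> (\<forall>a\<in>A. \<forall>b\<in>B. a < b) \<or> (\<forall>a\<in>A. \<forall>b\<in>B. b < a)"
proof
  have A: "x \<in> A" if "a \<in> A" "a' \<in> A" "a \<le> x" "x \<le> a'" for a a' x
    using assms(1) that unfolding is_interval_convex_1[symmetric] is_interval_1 by blast
  have B: "x \<in> B" if "b \<in> B" "b' \<in> B" "b \<le> x" "x \<le> b'" for b b' x
    using assms(2) that unfolding is_interval_convex_1[symmetric] is_interval_1 by blast
  assume disj: "A \<inter> B = {}"
  show "(\<forall>a\<in>A. \<forall>b\<in>B. a < b) \<or> (\<forall>a\<in>A. \<forall>b\<in>B. b < a)"
  proof (rule ccontr)
    assume "\<not> ?thesis"
    then obtain a b a' b' where *: "a \<in> A" "b \<in> B" "b \<le> a" "a' \<in> A" "b' \<in> B" "a' \<le> b'"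
      by (auto simp: not_less)
    show False
    \<comment> \<open>If \<open>b' \<le> a\<close>, then \<open>b'\<close> lies between
      \<open>a'\<close> and \<open>a\<close>, hence in \<open>A\<close>; otherwise \<open>a\<close>
      lies between \<open>b\<close> and \<open>b'\<close>, hence in \<open>B\<close>. Either way
      there is a common point.\<close>
    proof (cases "b' \<le> a")
      case True
      then show False using A[of a' a b'] * disj by blast
    next
      case False
      then show False using B[of b b' a] * disj by force
    qed
  qed
qed force

text \<open>Minimality of the hull is used twice: the points above all of \<open>S\<close> form a
  convex set containing \<open>T\<close>, hence its hull; the points below that hull form a convex
  set containing \<open>S\<close>.\<close>

lemma convex_hull_less_iff:
  fixes S T :: "real set"
  shows "(\<forall>a\<in>convex hull S. \<forall>b\<in>convex hull T. a < b) \<longleftrightarrow> (\<forall>a\<in>S. \<forall>b\<in>T. a < b)"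
proof
  assume less: "\<forall>a\<in>S. \<forall>b\<in>T. a < b"
  have "convex (\<Inter>a\<in>S. {a<..})"
    by (intro convex_INT convex_real_interval)
  then have "convex hull T \<subseteq> (\<Inter>a\<in>S. {a<..})"
    by (rule hull_minimal[rotated]) (use less in auto)
  moreover have "convex (\<Inter>b\<in>convex hull T. {..<b})"
    by (intro convex_INT convex_real_interval)
  ultimately have "convex hull S \<subseteq> (\<Inter>b\<in>convex hull T. {..<b})"
    by (intro hull_minimal) auto
  then show "\<forall>a\<in>convex hull S. \<forall>b\<in>convex hull T. a < b"
    by blast
qed (simp add: hull_inc)

text \<open>Vacuously true when one of the labels is absent, in agreement with an empty support
  being disjoint from every other.\<close>

definition precedes :: "nat \<Rightarrow> (nat \<Rightarrow> 'b) \<Rightarrow> 'b \<Rightarrow> 'b \<Rightarrow> bool" where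
  "precedes n y i j \<longleftrightarrow> (\<forall>k\<in>{1..n}. \<forall>l\<in>{1..n}. y k = i \<longrightarrow> y l = j \<longrightarrow> k < l)"

text \<open>Supports are convex, so if disjoint, one lies strictly to the left of the other; strict
  order of hulls is strict order of the spanning indices.\<close>

lemma empirical_support_disjoint_iff:
  "empirical_support n y i \<inter> empirical_support n y j = {} \<longleftrightarrow>
     precedes n y i j \<or> precedes n y j i"
proof -
  have "(\<forall>a\<in>empirical_support n y i. \<forall>b\<in>empirical_support n y j. a < b) \<longleftrightarrow> precedes n y i j"
    for i j
    unfolding empirical_support_def convex_hull_less_iff by (auto simp: precedes_def)
  then show ?thesis
    by (subst convex_real_inter_empty_iff)
      (auto simp: empirical_support_def)
qed

text \<open>One occurrence of each label would give indices with \<open>k < l\<close> and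
  \<open>l < k\<close>.\<close>

lemma precedes_both_iff:
  assumes "i \<noteq> j"
  shows "precedes n y i j \<and> precedes n y j i \<longleftrightarrow>
    (\<forall>l\<in>{1..n}. y l \<noteq> i) \<or> (\<forall>l\<in>{1..n}. y l \<noteq> j)"
proof
  assume "precedes n y i j \<and> precedes n y j i"
  then show "(\<forall>l\<in>{1..n}. y l \<noteq> i) \<or> (\<forall>l\<in>{1..n}. y l \<noteq> j)"
    unfolding precedes_def by (meson less_asym)
qed (auto simp: precedes_def)

text \<open>The witness \<open>s\<close> is the last occurrence of \<open>i\<close>. For fixed
  \<open>s\<close> each \<open>y l\<close> is confined to a set of its own, so under independence
  the probability becomes a product.\<close>

lemma precedes_iff_last_occurrence:
  assumes "i \<noteq> j"
  shows "precedes n y i j \<longleftrightarrow> (\<forall>l\<in>{1..n}. y l \<noteq> i) \<or>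
    (\<exists>s\<in>{1..n}. \<forall>l\<in>{1..n}. y l \<in> (if l < s then - {j} else if l = s then {i} else - {i}))"
    (is "_ \<longleftrightarrow> ?R")
proof
  assume prec: "precedes n y i j"
  define L where "L = {l \<in> {1..n}. y l = i}"
  have fin: "finite L" by (simp add: L_def)
  show ?R
  proof (cases "L = {}")
    case False
    have s: "Max L \<in> L" using fin False by (rule Max_in)
    have "y l \<in> (if l < Max L then - {j} else if l = Max L then {i} else - {i})"
      if l: "l \<in> {1..n}" for l
    proof -
      have "y l \<noteq> j" if "l < Max L"
        using prec s l that unfolding precedes_def L_def by force
      moreover have "y l \<noteq> i" if "Max L < l"
        proof -
        have "l \<notin> L" using Max_ge[OF fin, of l] that by linarith
        then show ?thesis using l by (simp add: L_def)
      qed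
      ultimately show ?thesis using s by (auto simp: L_def)
    qed
    then show ?thesis using s unfolding L_def by blast
  qed (auto simp: L_def)
next
  assume ?R
  then show "precedes n y i j"
  proof
    assume "\<exists>s\<in>{1..n}. \<forall>l\<in>{1..n}. y l \<in> (if l < s then - {j} else if l = s then {i} else - {i})"
    then obtain s where s: "s \<in> {1..n}" "\<And>l. l \<in> {1..n} \<Longrightarrow>
        y l \<in> (if l < s then - {j} else if l = s then {i} else - {i})"
      by blast
    have "k < l" if "k \<in> {1..n}" "l \<in> {1..n}" "y k = i" "y l = j" for k l
    proof -
      \<comment> \<open>Label \<open>i\<close> is excluded after \<open>s\<close>. Label
        \<open>j\<close> is excluded before \<open>s\<close>, and also at \<open>s\<close>, where
        \<open>i\<close> stands.\<close>
      have "k \<le> s" using s(2)[of k] that by (auto split: if_splits)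
      moreover have "s < l" using s(2)[of l] that assms by (auto split: if_splits)
      ultimately show ?thesis by simp
    qed
    then show ?thesis unfolding precedes_def by blast
  qed (auto simp: precedes_def)
qed

text \<open>Each edge is represented by its increasing pair. Supports that meet are nonempty, so
  both labels are then vertices.\<close>

lemma card_nerve_edges:
  "card (nerve_edges m n y) = card {(i, j). 1 \<le> i \<and> i < j \<and> j \<le> m \<and>
     \<not> precedes n y i j \<and> \<not> precedes n y j i}"
proof -
  let ?P = "{(i, j). 1 \<le> i \<and> i < j \<and> j \<le> m \<and> \<not> precedes n y i j \<and> \<not> precedes n y j i}"
  have inj: "inj_on (\<lambda>(i, j). {i, j}) ?P"
    by (auto simp: inj_on_def doubleton_eq_iff)
  have "nerve_edges m n y = {{i, j} |i j. i \<in> {1..m} \<and> j \<in> {1..m} \<and> i \<noteq> j \<and>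
      empirical_support n y i \<inter> empirical_support n y j \<noteq> {}}"
    unfolding nerve_edges_def nerve_vertices_def by blast
  also have "\<dots> = (\<lambda>(i, j). {i, j}) ` ?P"
  proof (intro equalityI subsetI)
    fix e assume "e \<in> {{i, j} |i j. i \<in> {1..m} \<and> j \<in> {1..m} \<and> i \<noteq> j \<and>
      empirical_support n y i \<inter> empirical_support n y j \<noteq> {}}"
    then obtain i j where e: "e = {i, j}" and "i \<in> {1..m}" "j \<in> {1..m}" "i \<noteq> j"
      "\<not> precedes n y i j" "\<not> precedes n y j i"
      by (auto simp: empirical_support_disjoint_iff)
    then have "(min i j, max i j) \<in> ?P" by (auto simp: min_def max_def)
    moreover have "e = (\<lambda>(i, j). {i, j}) (min i j, max i j)"
      using e by (auto simp: min_def max_def)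
    ultimately show "e \<in> (\<lambda>(i, j). {i, j}) ` ?P" by blast
  qed (force simp: empirical_support_disjoint_iff)
  finally show ?thesis
    by (simp only: card_image[OF inj])
qed

section \<open>Binomial sums and last-occurrence sums\<close>

lemma binomial_sum_Suc:
  fixes c :: "'a :: comm_semiring_1"
  shows "(\<Sum>k\<le>Suc n. of_nat (Suc n choose k) * g k * c ^ (Suc n - k)) =
    (\<Sum>k\<le>n. of_nat (n choose k) * (c * g k + g (Suc k)) * c ^ (n - k))"
proof -
  \<comment> \<open>The bound rises to \<open>Suc n\<close> for free because
    \<open>n choose Suc n\<close> is 0. Splitting off \<open>k = 0\<close> on both sides then leaves
    Pascal's rule.\<close>
  have "(\<Sum>k\<le>n. of_nat (n choose k) * (c * g k) * c ^ (n - k)) =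
      (\<Sum>k\<le>Suc n. of_nat (n choose k) * g k * c ^ (Suc n - k))"
    by (auto intro!: sum.cong simp: Suc_diff_le mult_ac binomial_eq_0)
  also have "\<dots> = g 0 * c ^ Suc n + (\<Sum>k\<le>n. of_nat (n choose Suc k) * g (Suc k) * c ^ (n - k))"
    by (subst sum.atMost_Suc_shift) simp
  finally show ?thesis
    by (subst sum.atMost_Suc_shift) (simp add: sum.distrib algebra_simps)
qed

text \<open>For \<open>c = 1 - a - b\<close> both sides are the probability that \<open>i\<close>
  precedes \<open>j\<close>: the left sorts by the number \<open>k\<close> of positions holding
  \<open>i\<close> or \<open>j\<close>, the first \<open>r\<close> of which hold \<open>i\<close>;
  the right sorts by the last \<open>i\<close>. Both sides satisfy
  \<open>u (Suc n) = (c + b) * u n + a * (c + a) ^ n\<close> with \<open>u 0 = 1\<close>.\<close>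

lemma binomial_sum_monomials:
  fixes a b c :: real
  shows "(\<Sum>k\<le>n. real (n choose k) * (\<Sum>r\<le>k. a ^ r * b ^ (k - r)) * c ^ (n - k)) =
    (c + b) ^ n + (\<Sum>s=1..n. a * (c + a) ^ (s - 1) * (c + b) ^ (n - s))"
proof (induction n)
  case (Suc n)
  define h where "h k = (\<Sum>r\<le>k. a ^ r * b ^ (k - r))" for k
  \<comment> \<open>The last term is the monomial \<open>r = Suc k\<close>; all others contain a
    factor \<open>b\<close>.\<close>
  have h: "h (Suc k) = b * h k + a * a ^ k" for k
    by (auto simp: h_def sum_distrib_left Suc_diff_le mult_ac intro!: sum.cong)
  have "(\<Sum>k\<le>Suc n. real (Suc n choose k) * h k * c ^ (Suc n - k)) =
      (\<Sum>k\<le>n. real (n choose k) * (c * h k + h (Suc k)) * c ^ (n - k))"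
    by (rule binomial_sum_Suc)
  also have "\<dots> = (c + b) * (\<Sum>k\<le>n. real (n choose k) * h k * c ^ (n - k)) +
      a * (\<Sum>k\<le>n. real (n choose k) * a ^ k * c ^ (n - k))"
    unfolding h sum_distrib_left sum.distrib[symmetric]
    by (intro sum.cong refl) (simp only: algebra_simps)
  also have "(\<Sum>k\<le>n. real (n choose k) * a ^ k * c ^ (n - k)) = (c + a) ^ n"
    by (subst add.commute) (simp add: binomial_ring)
  also have "(c + b) * (\<Sum>k\<le>n. real (n choose k) * h k * c ^ (n - k)) + a * (c + a) ^ n =
      (c + b) ^ Suc n + (\<Sum>s=1..Suc n. a * (c + a) ^ (s - 1) * (c + b) ^ (Suc n - s))"
    \<comment> \<open>The summand \<open>s = Suc n\<close> is the new one; in the others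
      \<open>c + b\<close> raises the exponent \<open>n - s\<close> by one.\<close>
    unfolding Suc.IH[folded h_def]
    by (auto simp: distrib_left sum_distrib_left Suc_diff_le mult_ac intro!: sum.cong)
  finally show ?case by (simp only: h_def)
qed simp

text \<open>Inclusion-exclusion in algebraic form: the sums for the two orders are added, and the
  words lacking one of the labels, which satisfy both orders, are subtracted once.\<close>

lemma binomial_sum_two_labels:
  fixes a b c :: real
  shows "c ^ n + (\<Sum>k=1..n. real (n choose k) *
      (2 * (\<Sum>r=1..k-1. a ^ r * b ^ (k - r)) + a ^ k + b ^ k) * c ^ (n - k)) =
    (c + b) ^ n + (\<Sum>s=1..n. a * (c + a) ^ (s - 1) * (c + b) ^ (n - s)) +
    ((c + a) ^ n + (\<Sum>s=1..n. b * (c + b) ^ (s - 1) * (c + a) ^ (n - s))) -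
    ((c + a) ^ n + (c + b) ^ n - c ^ n)"
proof -
  let ?h = "\<lambda>a b k. \<Sum>r\<le>k. a ^ r * b ^ (k - r) :: real"
  \<comment> \<open>Symmetry lets \<open>2 * ?h a b k\<close> be read as one contribution from each
    order.\<close>
  have sym: "?h b a k = ?h a b k" for k
    by (rule sum.reindex_bij_witness[of _ "\<lambda>r. k - r" "\<lambda>r. k - r"]) (auto simp: mult.commute)
  \<comment> \<open>Doubling \<open>?h\<close> counts its end terms \<open>b ^ k\<close> and
    \<open>a ^ k\<close> twice. They are distinct summands only for
    \<open>k \<ge> 1\<close>.\<close>
  have h: "2 * (\<Sum>r=1..k-1. a ^ r * b ^ (k - r)) + a ^ k + b ^ k = 2 * ?h a b k - a ^ k - b ^ k"
    if "k \<in> {1..n}" for k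
  proof -
    have "{..k} = insert 0 (insert k {1..k-1})" using that by auto
    then show ?thesis using that by (auto simp: not_le)
  qed
  have "c ^ n + (\<Sum>k=1..n. real (n choose k) *
      (2 * (\<Sum>r=1..k-1. a ^ r * b ^ (k - r)) + a ^ k + b ^ k) * c ^ (n - k)) =
      c ^ n + (\<Sum>k=1..n. real (n choose k) * (2 * ?h a b k - a ^ k - b ^ k) * c ^ (n - k))"
    by (intro arg_cong2[where f = "(+)"] sum.cong refl) (simp only: h)
  also have "\<dots> = c ^ n + (\<Sum>k=1..n. real (n choose k) * (?h a b k + ?h b a k - a ^ k - b ^ k)
      * c ^ (n - k))"
    by (simp add: sym)
  \<comment> \<open>The summand \<open>k = 0\<close> may be added since its bracket is 1 + 1 - 1 - 1
    = 0.\<close>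
  also have "\<dots> = c ^ n +
      (\<Sum>k\<le>n. real (n choose k) * (?h a b k + ?h b a k - a ^ k - b ^ k) * c ^ (n - k))"
  proof -
    have "{..n} = insert 0 {1..n}" by auto
    then show ?thesis by simp
  qed
  also have "\<dots> = c ^ n + (\<Sum>k\<le>n. real (n choose k) * ?h a b k * c ^ (n - k)) +
      (\<Sum>k\<le>n. real (n choose k) * ?h b a k * c ^ (n - k)) -
      (\<Sum>k\<le>n. real (n choose k) * a ^ k * c ^ (n - k)) -
      (\<Sum>k\<le>n. real (n choose k) * b ^ k * c ^ (n - k))"
    by (simp add: sum.distrib sum_subtractf ring_distribs)
  also have "(\<Sum>k\<le>n. real (n choose k) * a ^ k * c ^ (n - k)) = (c + a) ^ n"
    by (subst add.commute) (simp add: binomial_ring)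
  also have "(\<Sum>k\<le>n. real (n choose k) * b ^ k * c ^ (n - k)) = (c + b) ^ n"
    by (subst add.commute) (simp add: binomial_ring)
  finally show ?thesis
    unfolding binomial_sum_monomials by simp
qed

section \<open>Probabilities of the order events\<close>

context prob_space
begin

lemma prob_indep_vars_Ball:
  assumes indep: "indep_vars (\<lambda>_. count_space UNIV) Y I" and "finite I"
  shows "prob {\<omega> \<in> space M. \<forall>l\<in>I. Y l \<omega> \<in> S l} = (\<Prod>l\<in>I. prob {\<omega> \<in> space M. Y l \<omega> \<in> S l})"
proof (cases "I = {}")
  case False
  have "prob (\<Inter>l\<in>I. Y l -` S l \<inter> space M) = (\<Prod>l\<in>I. prob (Y l -` S l \<inter> space M))"
    using indep False \<open>finite I\<close> by (intro indep_varsD) auto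
  moreover have "(\<Inter>l\<in>I. Y l -` S l \<inter> space M) = {\<omega> \<in> space M. \<forall>l\<in>I. Y l \<omega> \<in> S l}"
    using False by auto
  moreover have "Y l -` S l \<inter> space M = {\<omega> \<in> space M. Y l \<omega> \<in> S l}" for l
    by auto
  ultimately show ?thesis by simp
qed (simp add: prob_space)

context
  fixes Y :: "nat \<Rightarrow> 'a \<Rightarrow> 'b" and n :: nat and i j :: 'b and a b :: real
  assumes indep: "indep_vars (\<lambda>_. count_space UNIV) Y {1..n}"
    and ij: "i \<noteq> j"
    and prob_i: "\<And>l. l \<in> {1..n} \<Longrightarrow> prob {\<omega> \<in> space M. Y l \<omega> = i} = a"
    and prob_j: "\<And>l. l \<in> {1..n} \<Longrightarrow> prob {\<omega> \<in> space M. Y l \<omega> = j} = b"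
begin

lemma label_event: "l \<in> {1..n} \<Longrightarrow> {\<omega> \<in> space M. Y l \<omega> \<in> S} \<in> events"
  using indep measurable_sets[of "Y l" M "count_space UNIV" S]
  by (auto simp: indep_vars_def vimage_def Int_def conj_commute)

lemma word_event: "{\<omega> \<in> space M. \<forall>l\<in>{1..n}. Y l \<omega> \<in> S l} \<in> events"
  using label_event by (intro sets.sets_Collect_finite_All) auto

lemma prob_not_label:
  assumes "l \<in> {1..n}"
  shows "prob {\<omega> \<in> space M. Y l \<omega> \<in> - {i}} = 1 - a"
    and "prob {\<omega> \<in> space M. Y l \<omega> \<in> - {j}} = 1 - b"
    and "prob {\<omega> \<in> space M. Y l \<omega> \<in> - {i, j}} = 1 - a - b"
proof -
  have neg: "prob {\<omega> \<in> space M. Y l \<omega> \<in> - S} = 1 - prob {\<omega> \<in> space M. Y l \<omega> \<in> S}" for S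
    using prob_neg[OF label_event[OF assms, of S]] by simp
  show "prob {\<omega> \<in> space M. Y l \<omega> \<in> - {i}} = 1 - a"
    "prob {\<omega> \<in> space M. Y l \<omega> \<in> - {j}} = 1 - b"
    using neg[of "{i}"] neg[of "{j}"] prob_i[OF assms] prob_j[OF assms] by simp_all
  have "{\<omega> \<in> space M. Y l \<omega> \<in> {i, j}} =
      {\<omega> \<in> space M. Y l \<omega> \<in> {i}} \<union> {\<omega> \<in> space M. Y l \<omega> \<in> {j}}"
    by auto
  then have "prob {\<omega> \<in> space M. Y l \<omega> \<in> {i, j}} =
      prob {\<omega> \<in> space M. Y l \<omega> \<in> {i}} + prob {\<omega> \<in> space M. Y l \<omega> \<in> {j}}"
    using ij by (simp only:) (rule finite_measure_Union; use label_event[OF assms] in blast)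
  then show "prob {\<omega> \<in> space M. Y l \<omega> \<in> - {i, j}} = 1 - a - b"
    using neg[of "{i, j}"] prob_i[OF assms] prob_j[OF assms] by simp
qed

lemma prob_no_occurrence:
  shows "prob {\<omega> \<in> space M. \<forall>l\<in>{1..n}. Y l \<omega> \<in> - {i}} = (1 - a) ^ n"
    and "prob {\<omega> \<in> space M. \<forall>l\<in>{1..n}. Y l \<omega> \<in> - {j}} = (1 - b) ^ n"
    and "prob {\<omega> \<in> space M. \<forall>l\<in>{1..n}. Y l \<omega> \<in> - {i, j}} = (1 - a - b) ^ n"
  using prob_not_label by (simp_all only: prob_indep_vars_Ball[OF indep] finite_atLeastAtMost) simp_all

lemma precedes_event: "{\<omega> \<in> space M. precedes n (\<lambda>l. Y l \<omega>) i j} \<in> events"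
proof -
  have "{\<omega> \<in> space M. precedes n (\<lambda>l. Y l \<omega>) i j} =
    {\<omega> \<in> space M. \<forall>l\<in>{1..n}. Y l \<omega> \<in> - {i}} \<union> (\<Union>s\<in>{1..n}. {\<omega> \<in> space M. \<forall>l\<in>{1..n}.
      Y l \<omega> \<in> (if l < s then - {j} else if l = s then {i} else - {i})})"
    unfolding precedes_iff_last_occurrence[OF ij] by blast
  also have "\<dots> \<in> events"
    by (intro sets.Un sets.finite_UN word_event) simp
  finally show ?thesis .
qed

text \<open>Either \<open>i\<close> is absent, or its last occurrence is at some \<open>s\<close>:
  \<open>s - 1\<close> positions avoid \<open>j\<close>, one holds \<open>i\<close>, and
  \<open>n - s\<close> avoid \<open>i\<close>. These events are disjoint.\<close>

lemma prob_precedes: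
  "prob {\<omega> \<in> space M. precedes n (\<lambda>l. Y l \<omega>) i j} =
    (1 - a) ^ n + (\<Sum>s=1..n. a * (1 - b) ^ (s - 1) * (1 - a) ^ (n - s))"
proof -
  let ?S = "\<lambda>s l. if l < s then - {j} else if l = s then {i} else - {i}"
  let ?E = "\<lambda>s. {\<omega> \<in> space M. \<forall>l\<in>{1..n}. Y l \<omega> \<in> ?S s l}"
  let ?N = "{\<omega> \<in> space M. \<forall>l\<in>{1..n}. Y l \<omega> \<in> - {i}}"
  have E: "prob (?E s) = a * (1 - b) ^ (s - 1) * (1 - a) ^ (n - s)" if s: "s \<in> {1..n}" for s
  proof -
    have "prob (?E s) = (\<Prod>l=1..n. prob {\<omega> \<in> space M. Y l \<omega> \<in> ?S s l})"
      by (rule prob_indep_vars_Ball[OF indep]) simp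
    also have "\<dots> = (\<Prod>l=1..n. if l < s then 1 - b else if l = s then a else 1 - a)"
      using prob_not_label prob_i by (intro prod.cong) auto
    also have "\<dots> = (\<Prod>l\<in>insert s ({1..<s} \<union> {s<..n}).
        if l < s then 1 - b else if l = s then a else 1 - a)"
      using s by (intro prod.cong) auto
    also have "\<dots> = a * ((\<Prod>l\<in>{1..<s}. 1 - b) * (\<Prod>l\<in>{s<..n}. 1 - a))"
      by (subst prod.insert, simp, simp, subst prod.union_disjoint)
        (auto intro!: arg_cong2[where f = "(*)"] prod.cong)
    also have "\<dots> = a * (1 - b) ^ (s - 1) * (1 - a) ^ (n - s)" by simp
    finally show ?thesis .
  qed
  have disj: "disjoint_family_on ?E {1..n}"
    unfolding disjoint_family_on_def
  proof (intro ballI impI)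
    \<comment> \<open>Position \<open>t\<close> must avoid \<open>i\<close> in \<open>?E s\<close>
      but hold \<open>i\<close> in \<open>?E t\<close>.\<close>
    have "?E s \<inter> ?E t = {}" if "s < t" "t \<in> {1..n}" for s t
    proof -
      have "?S s t = - {i}" "?S t t = {i}" using that by auto
      then show ?thesis using that by blast
    qed
    then show "?E s \<inter> ?E t = {}" if "s \<in> {1..n}" "t \<in> {1..n}" "s \<noteq> t" for s t
      using that by (cases "s < t") (blast, metis (no_types, lifting) Int_commute linorder_neqE_nat)
  qed
  have "{\<omega> \<in> space M. precedes n (\<lambda>l. Y l \<omega>) i j} = ?N \<union> (\<Union>s\<in>{1..n}. ?E s)"
    unfolding precedes_iff_last_occurrence[OF ij] by blast
  also have "prob \<dots> = prob ?N + prob (\<Union>s\<in>{1..n}. ?E s)"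
  proof (rule finite_measure_Union)
    have "?N \<inter> ?E s = {}" if "s \<in> {1..n}" for s
    proof -
      have "?S s s = {i}" by simp
      then show ?thesis using that by blast
    qed
    then show "?N \<inter> (\<Union>s\<in>{1..n}. ?E s) = {}" by blast
  qed (intro sets.finite_UN word_event finite_atLeastAtMost)+
  also have "prob (\<Union>s\<in>{1..n}. ?E s) = (\<Sum>s=1..n. prob (?E s))"
    using disj by (intro finite_measure_finite_Union image_subsetI word_event) auto
  also have "\<dots> = (\<Sum>s=1..n. a * (1 - b) ^ (s - 1) * (1 - a) ^ (n - s))"
    by (intro sum.cong refl E)
  finally show ?thesis
    by (simp only: prob_no_occurrence)
qed

text \<open>Inclusion-exclusion on the absence of \<open>i\<close> and the absence of
  \<open>j\<close>, whose intersection is the absence of both.\<close>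

lemma prob_precedes_both:
  "prob {\<omega> \<in> space M. precedes n (\<lambda>l. Y l \<omega>) i j \<and> precedes n (\<lambda>l. Y l \<omega>) j i} =
    (1 - a) ^ n + (1 - b) ^ n - (1 - a - b) ^ n"
proof -
  let ?N = "\<lambda>S. {\<omega> \<in> space M. \<forall>l\<in>{1..n}. Y l \<omega> \<in> - S}"
  have "{\<omega> \<in> space M. precedes n (\<lambda>l. Y l \<omega>) i j \<and> precedes n (\<lambda>l. Y l \<omega>) j i} =
      ?N {i} \<union> ?N {j}"
    unfolding precedes_both_iff[OF ij] by blast
  also have "prob \<dots> = prob (?N {i}) + prob (?N {j}) - prob (?N {i} \<inter> ?N {j})"
    by (intro measure_Un3 fmeasurableI word_event) (simp_all add: less_top[symmetric])
  also have "?N {i} \<inter> ?N {j} = ?N {i, j}" by blast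
  finally show ?thesis by (simp only: prob_no_occurrence)
qed

end

text \<open>The complement is the union of the two orders. The second order is the first with the
  roles of \<open>i\<close>, \<open>a\<close> and \<open>j\<close>, \<open>b\<close> exchanged; the
  last bracket is the probability of both.\<close>

lemma prob_supports_meet:
  fixes Y :: "nat \<Rightarrow> 'a \<Rightarrow> 'b"
  assumes indep: "indep_vars (\<lambda>_. count_space UNIV) Y {1..n}"
    and ij: "i \<noteq> j"
    and prob_i: "\<And>l. l \<in> {1..n} \<Longrightarrow> prob {\<omega> \<in> space M. Y l \<omega> = i} = a"
    and prob_j: "\<And>l. l \<in> {1..n} \<Longrightarrow> prob {\<omega> \<in> space M. Y l \<omega> = j} = b"
  defines "E \<equiv> {\<omega> \<in> space M. \<not> precedes n (\<lambda>l. Y l \<omega>) i j \<and> \<not> precedes n (\<lambda>l. Y l \<omega>) j i}"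
  shows "E \<in> events"
    and "prob E = 1 -
      ((1 - a) ^ n + (\<Sum>s=1..n. a * (1 - b) ^ (s - 1) * (1 - a) ^ (n - s)) +
       ((1 - b) ^ n + (\<Sum>s=1..n. b * (1 - a) ^ (s - 1) * (1 - b) ^ (n - s))) -
       ((1 - b) ^ n + (1 - a) ^ n - (1 - a - b) ^ n))"
proof -
  let ?P = "\<lambda>i j. {\<omega> \<in> space M. precedes n (\<lambda>l. Y l \<omega>) i j}"
  have ev: "?P i j \<in> events" "?P j i \<in> events"
    using precedes_event[OF indep ij prob_i prob_j]
      precedes_event[OF indep ij[symmetric] prob_j prob_i] by auto
  have E: "E = space M - (?P i j \<union> ?P j i)"
    unfolding E_def by blast
  show "E \<in> events" unfolding E using ev by blast
  have "prob E = 1 - prob (?P i j \<union> ?P j i)"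
    unfolding E using ev by (intro prob_compl sets.Un)
  also have "prob (?P i j \<union> ?P j i) = prob (?P i j) + prob (?P j i) - prob (?P i j \<inter> ?P j i)"
    using ev by (intro measure_Un3 fmeasurableI) (simp_all add: less_top[symmetric])
  also have "?P i j \<inter> ?P j i =
      {\<omega> \<in> space M. precedes n (\<lambda>l. Y l \<omega>) i j \<and> precedes n (\<lambda>l. Y l \<omega>) j i}"
    by blast
  finally show "prob E = 1 -
      ((1 - a) ^ n + (\<Sum>s=1..n. a * (1 - b) ^ (s - 1) * (1 - a) ^ (n - s)) +
       ((1 - b) ^ n + (\<Sum>s=1..n. b * (1 - a) ^ (s - 1) * (1 - b) ^ (n - s))) -
       ((1 - b) ^ n + (1 - a) ^ n - (1 - a - b) ^ n))"
    using prob_precedes[OF indep ij prob_i prob_j] prob_precedes[OF indep ij[symmetric] prob_j prob_i]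
      prob_precedes_both[OF indep ij prob_i prob_j]
    by simp
qed

section \<open>Expected number of edges\<close>

lemma expectation_card_Collect:
  assumes "finite A" and ev: "\<And>x. x \<in> A \<Longrightarrow> {\<omega> \<in> space M. R x \<omega>} \<in> events"
  shows "expectation (\<lambda>\<omega>. real (card {x \<in> A. R x \<omega>})) = (\<Sum>x\<in>A. prob {\<omega> \<in> space M. R x \<omega>})"
proof -
  have "expectation (\<lambda>\<omega>. real (card {x \<in> A. R x \<omega>})) =
      expectation (\<lambda>\<omega>. \<Sum>x\<in>A. indicator {\<omega> \<in> space M. R x \<omega>} \<omega>)"
  proof (rule Bochner_Integration.integral_cong[OF refl])
    fix \<omega> assume "\<omega> \<in> space M"
    then have "(\<Sum>x\<in>A. indicator {\<omega> \<in> space M. R x \<omega>} \<omega> :: real) = (\<Sum>x\<in>A. if R x \<omega> then 1 else 0)"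
      by (intro sum.cong) (auto simp: indicator_def)
    also have "\<dots> = real (card {x \<in> A. R x \<omega>})"
      using \<open>finite A\<close> by (subst sum.If_cases) (auto simp: Int_def)
    finally show "real (card {x \<in> A. R x \<omega>}) = (\<Sum>x\<in>A. indicator {\<omega> \<in> space M. R x \<omega>} \<omega>)" ..
  qed
  also have "\<dots> = (\<Sum>x\<in>A. expectation (indicator {\<omega> \<in> space M. R x \<omega>}))"
    using ev by (intro Bochner_Integration.integral_sum) (auto simp: less_top[symmetric])
  also have "\<dots> = (\<Sum>x\<in>A. prob {\<omega> \<in> space M. R x \<omega>})"
    using ev by (intro sum.cong refl) (simp add: Int_absorb2)
  finally show ?thesis .
qed

end

lemma card_ordered_pairs:
  "card {(i, j). 1 \<le> i \<and> i < j \<and> j \<le> m} = m choose 2"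
proof -
  \<comment> \<open>Pairs are grouped by their larger entry \<open>j\<close>, which leaves
    \<open>j - 1\<close> smaller ones.\<close>
  have "{(i, j). 1 \<le> i \<and> i < j \<and> j \<le> m} = prod.swap ` (SIGMA j:{1..m}. {1..<j})"
    by force
  then have "card {(i, j). 1 \<le> i \<and> i < j \<and> j \<le> m} = card (SIGMA j:{1..m}. {1..<j})"
    by (simp add: card_image)
  also have "\<dots> = (\<Sum>j=1..m. j - 1)" by simp
  also have "\<dots> = m choose 2"
    by (induction m) (auto simp: numeral_2_eq_2)
  finally show ?thesis .
qed

theorem corollary8:
  fixes M :: "'a measure" and Y :: "nat \<Rightarrow> 'a \<Rightarrow> nat" and p :: "nat \<Rightarrow> real"
    and m n :: nat and q :: "nat \<Rightarrow> nat \<Rightarrow> real" and X :: "'a \<Rightarrow> real"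
  assumes "m \<ge> 1" and "n \<ge> 1"
    and "\<And>i. i \<in> {1..m} \<Longrightarrow> p i > 0"
    and "(\<Sum>i=1..m. p i) = 1"
    and "prob_space M"
    and "prob_space.indep_vars M (\<lambda>_. count_space UNIV) Y {1..n}"
    and "\<And>l i. l \<in> {1..n} \<Longrightarrow> i \<in> {1..m} \<Longrightarrow>
           measure M {\<omega> \<in> space M. Y l \<omega> = i} = p i"
  defines "q \<equiv> \<lambda>i j. 1 - (p i + p j)"
    and "X \<equiv> \<lambda>\<omega>. real (card (nerve_edges m n (\<lambda>l. Y l \<omega>)))"
  shows "prob_space.expectation M X =
           (\<Sum>(i, j) \<in> {(i, j). 1 \<le> i \<and> i < j \<and> j \<le> m}.
              1 - q i j ^ n
                - (\<Sum>k=1..n. real (n choose k)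
                    * (2 * (\<Sum>r=1..k-1. p i ^ r * p j ^ (k - r)) + p i ^ k + p j ^ k)
                    * q i j ^ (n - k)))
         \<and> ((\<forall>i\<in>{1..m}. p i = 1 / real m) \<longrightarrow>
              prob_space.expectation M X =
                real (m choose 2)
                  * (1 - (2 * real n * (real m - 1) ^ (n - 1) + (real m - 2) ^ n) / real m ^ n))"
proof -
  interpret prob_space M by fact
  let ?A = "{(i, j). 1 \<le> i \<and> i < j \<and> j \<le> m}"
  let ?R = "\<lambda>(i, j) \<omega>. \<not> precedes n (\<lambda>l. Y l \<omega>) i j \<and> \<not> precedes n (\<lambda>l. Y l \<omega>) j i"
  \<comment> \<open>The probability that the supports of two labels with masses \<open>a\<close> and
    \<open>b\<close> are disjoint, in last-occurrence form.\<close>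
  let ?F = "\<lambda>a b. (1 - a) ^ n + (\<Sum>s=1..n. a * (1 - b) ^ (s - 1) * (1 - a) ^ (n - s)) +
       ((1 - b) ^ n + (\<Sum>s=1..n. b * (1 - a) ^ (s - 1) * (1 - b) ^ (n - s))) -
       ((1 - b) ^ n + (1 - a) ^ n - (1 - a - b) ^ n) :: real"
  have fin: "finite ?A"
    by (rule finite_subset[of _ "{1..m} \<times> {1..m}"]) auto
  have meet: "{\<omega> \<in> space M. ?R x \<omega>} \<in> events"
    "prob {\<omega> \<in> space M. ?R x \<omega>} = 1 - ?F (p (fst x)) (p (snd x))" if "x \<in> ?A" for x
  proof -
    obtain i j where x: "x = (i, j)" "1 \<le> i" "i < j" "j \<le> m" using \<open>x \<in> ?A\<close> by auto
    have "i \<noteq> j" "\<And>l. l \<in> {1..n} \<Longrightarrow> prob {\<omega> \<in> space M. Y l \<omega> = i} = p i"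
      "\<And>l. l \<in> {1..n} \<Longrightarrow> prob {\<omega> \<in> space M. Y l \<omega> = j} = p j"
      using x assms(7) by auto
    note * = prob_supports_meet[OF assms(6) this]
    show "{\<omega> \<in> space M. ?R x \<omega>} \<in> events"
      "prob {\<omega> \<in> space M. ?R x \<omega>} = 1 - ?F (p (fst x)) (p (snd x))"
      using * unfolding x by simp_all
  qed
  have "X = (\<lambda>\<omega>. real (card {x \<in> ?A. ?R x \<omega>}))"
    unfolding X_def card_nerve_edges
    by (intro ext arg_cong[where f = real] arg_cong[where f = card]) auto
  then have "expectation X = (\<Sum>x\<in>?A. prob {\<omega> \<in> space M. ?R x \<omega>})"
    using expectation_card_Collect[OF fin, of ?R] meet(1) by simp
  also have "\<dots> = (\<Sum>(i, j)\<in>?A. 1 - ?F (p i) (p j))"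
  proof (intro sum.cong refl)
    show "prob {\<omega> \<in> space M. ?R x \<omega>} = (case x of (i, j) \<Rightarrow> 1 - ?F (p i) (p j))" if "x \<in> ?A" for x
      using meet(2)[OF that] by (simp add: split_beta)
  qed
  finally have EX: "expectation X = (\<Sum>(i, j)\<in>?A. 1 - ?F (p i) (p j))" .
  have F: "1 - ?F (p i) (p j) = 1 - q i j ^ n
                - (\<Sum>k=1..n. real (n choose k)
                    * (2 * (\<Sum>r=1..k-1. p i ^ r * p j ^ (k - r)) + p i ^ k + p j ^ k)
                    * q i j ^ (n - k))" for i j
  proof -
    \<comment> \<open>With \<open>c = q i j\<close>, the mass of the other labels, the right side of
      the binomial identity becomes \<open>?F\<close>.\<close>
    have q: "q i j + p i = 1 - p j" "q i j + p j = 1 - p i" "1 - p i - p j = q i j"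
      by (simp_all add: q_def)
    from binomial_sum_two_labels[of "q i j" n "p i" "p j"] show ?thesis
      unfolding q by linarith
  qed
  have "expectation X = real (m choose 2)
          * (1 - (2 * real n * (real m - 1) ^ (n - 1) + (real m - 2) ^ n) / real m ^ n)"
    if unif: "\<forall>i\<in>{1..m}. p i = 1 / real m"
  proof -
    let ?a = "1 / real m"
    \<comment> \<open>The uniform case is evaluated in last-occurrence form, where no binomial sum
      appears.\<close>
    have "expectation X = (\<Sum>(i, j)\<in>?A. 1 - ?F ?a ?a)"
      unfolding EX using unif by (intro sum.cong) auto
    also have "\<dots> = real (m choose 2) * (1 - ?F ?a ?a)"
      by (simp add: card_ordered_pairs[simplified])
    \<comment> \<open>For equal masses the two sums coincide and the powers of \<open>1 - ?a\<close>
      outside them cancel.\<close>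
    also have "?F ?a ?a = 2 * (\<Sum>s=1..n. ?a * (1 - ?a) ^ (s - 1) * (1 - ?a) ^ (n - s)) + (1 - ?a - ?a) ^ n"
      by simp
    also have "(\<Sum>s=1..n. ?a * (1 - ?a) ^ (s - 1) * (1 - ?a) ^ (n - s)) =
        (\<Sum>s=1..n. ?a * (1 - ?a) ^ (n - 1))"
      \<comment> \<open>The exponents \<open>s - 1\<close> and \<open>n - s\<close> add up to
        \<open>n - 1\<close>, so the summand does not depend on \<open>s\<close>.\<close>
      by (intro sum.cong refl) (auto simp: mult.assoc power_add[symmetric] simp del: power_Suc)
    also have "\<dots> = real n * (?a * (1 - ?a) ^ (n - 1))" by simp
    also have "?a * (1 - ?a) ^ (n - 1) = (real m - 1) ^ (n - 1) / real m ^ n"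
    proof -
      have "1 - ?a = (real m - 1) / real m" using assms(1) by (simp add: field_simps)
      \<comment> \<open>As \<open>n \<ge> 1\<close>, the denominators \<open>real m\<close> and
        \<open>real m ^ (n - 1)\<close> combine to \<open>real m ^ n\<close>.\<close>
      then show ?thesis using assms(2) by (cases n) (auto simp: power_divide)
    qed
    also have "1 - ?a - ?a = (real m - 2) / real m" using assms(1) by (simp add: field_simps)
    finally show ?thesis by (simp add: power_divide add_divide_distrib)
  qed
  then show ?thesis unfolding EX F by blast
qed

end
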